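(* Let $w, s, m_0, m_1, \ldots, m_s$ be positive integers with $w \le \sum_{i=0}^s m_i$, and let $F$ be a set consisting of a single state. The Cards in Piles puzzle $C(w,s,m_0,\ldots,m_s;F)$ can always be solved when $w=1$. When $w>1$, the puzzle can always be solved except in the following two situations: (1) $s=1$; (2) $\sum_{i=0}^s m_i < w + \max\{m_i : 0\le i\le s\}$.
   Context: Cards in Piles: there is a set $W$ of $w$ distinct cards and $s+1$ piles numbered $0,\ldots,s$. A state is a tuple $(P_0,\ldots,P_s)$ of ordered subsets of $W$ (each read from bottom to top) that partition $W$, with $|P_i|\le m_i$ for each $i$. A move takes the top card of one pile and places it on top of another pile, provided the result is a state (no pile $i$ exceeds $m_i$ cards). The Cards in Piles graph $G(w,s,m_0,\ldots,m_s)$ is the undirected graph whose vertices are states and whose edges are moves. In the puzzle $C(w,s,m_0,\ldots,m_s;F)$ every state is a starting state and $F$ is a set containing one finishing state; the puzzle can always be solved if from every state there is a sequence of moves reaching the finishing state. *)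

theory Defs
  imports Main
begin

text \<open>
  A state is the list \<open>[P\<^sub>0, \<dots>, P\<^sub>s]\<close> of piles, and each pile is a list of cards read from bottom
  to top, so the top card of a nonempty pile is its \<^const>\<open>last\<close> element. Piles may be empty.
\<close>

definition is_state :: "'a set \<Rightarrow> nat \<Rightarrow> (nat \<Rightarrow> nat) \<Rightarrow> 'a list list \<Rightarrow> bool" where
  "is_state W s m P \<longleftrightarrow>
     length P = s + 1 \<and>
     (\<forall>i\<le>s. distinct (P ! i)) \<and>
     (\<forall>i\<le>s. \<forall>j\<le>s. i \<noteq> j \<longrightarrow> set (P ! i) \<inter> set (P ! j) = {}) \<and>
     (\<Union>i\<le>s. set (P ! i)) = W \<and>
     (\<forall>i\<le>s. length (P ! i) \<le> m i)"

definition is_move :: "'a set \<Rightarrow> nat \<Rightarrow> (nat \<Rightarrow> nat) \<Rightarrow> 'a list list \<Rightarrow> 'a list list \<Rightarrow> bool" where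
  "is_move W s m P Q \<longleftrightarrow>
     is_state W s m P \<and> is_state W s m Q \<and>
     (\<exists>i\<le>s. \<exists>j\<le>s. i \<noteq> j \<and> P ! i \<noteq> [] \<and>
        Q = P[i := butlast (P ! i), j := P ! j @ [last (P ! i)]])"

definition always_solvable ::
    "'a set \<Rightarrow> nat \<Rightarrow> (nat \<Rightarrow> nat) \<Rightarrow> 'a list list set \<Rightarrow> bool" where
  "always_solvable W s m F \<longleftrightarrow>
     (\<forall>P. is_state W s m P \<longrightarrow> (\<exists>Q\<in>F. (is_move W s m)\<^sup>*\<^sup>* P Q))"

end

theory Submission
  imports Defs "HOL-Library.Multiset" "HOL-Combinatorics.Transposition"
begin

text \<open>
  Suppose the number of free places is at least the largest capacity. Then whenever a pile is
  nonempty, some other pile has a free place. This suffices to bring any given card to the bottom of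
  any given pile, after which that card and the place below it can be forgotten: the number of cards
  and one capacity both drop by one, the number of free places does not change, and induction
  applies. Capacities are allowed to become zero on the way, as long as at least three piles stay
  usable or only one card is left. Conversely, if there are fewer free places than the largest
  capacity, the bottom card of the largest pile never moves; and with two piles the word read up
  the first pile and down the second is invariant.
\<close>

section \<open>Piles as functions\<close>

text \<open>The indices range over all naturals: where \<open>m\<close> is zero a pile can neither
  lose nor gain a card, so no index set has to be carried along.\<close>

definition step :: "(nat \<Rightarrow> nat) \<Rightarrow> (nat \<Rightarrow> 'a list) \<Rightarrow> (nat \<Rightarrow> 'a list) \<Rightarrow> bool" where
  "step m p q \<longleftrightarrow> (\<exists>i j. i \<noteq> j \<and> p i \<noteq> [] \<and> length (p j) < m j \<and>
     q = p(i := butlast (p i), j := p j @ [last (p i)]))"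

text \<open>One multiset equation stands for distinctness, disjointness and covering together.
  Removing a card then amounts to subtracting it from \<open>M\<close>. Capacities vanish outside
  \<open>I\<close>, which forces those piles to be empty.\<close>

definition config :: "nat set \<Rightarrow> (nat \<Rightarrow> nat) \<Rightarrow> 'a multiset \<Rightarrow> (nat \<Rightarrow> 'a list) \<Rightarrow> bool" where
  "config I m M p \<longleftrightarrow> finite I \<and> (\<forall>i. i \<notin> I \<longrightarrow> m i = 0) \<and>
     (\<forall>i. length (p i) \<le> m i) \<and> (\<Sum>i\<in>I. mset (p i)) = M"

text \<open>The free places, \<open>sum m I\<close> minus \<open>w\<close>, number at least every
  single capacity. The additive form avoids truncated subtraction.\<close>

definition slack :: "nat set \<Rightarrow> (nat \<Rightarrow> nat) \<Rightarrow> nat \<Rightarrow> bool" where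
  "slack I m w \<longleftrightarrow> (\<forall>k\<in>I. w + m k \<le> sum m I)"

lemma step_intro:
  assumes "i \<noteq> j" "p i \<noteq> []" "length (p j) < m j"
  shows "step m p (p(i := butlast (p i), j := p j @ [last (p i)]))"
  using assms unfolding step_def by blast

lemma config_nonempty_in: "config I m M p \<Longrightarrow> p i \<noteq> [] \<Longrightarrow> i \<in> I"
  unfolding config_def by (metis le_zero_eq length_0_conv)

lemma config_room_in: "config I m M p \<Longrightarrow> length (p i) < m i \<Longrightarrow> i \<in> I"
  unfolding config_def by (metis not_less0)

lemma config_step:
  assumes c: "config I m M p" and st: "step m p q"
  shows "config I m M q"
proof -
  obtain i j where ij: "i \<noteq> j" "p i \<noteq> []" "length (p j) < m j"
    and q: "q = p(i := butlast (p i), j := p j @ [last (p i)])"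
    using st unfolding step_def by blast
  have fin: "finite I" and iI: "i \<in> I" and jI: "j \<in> I - {i}"
    using c ij config_nonempty_in[OF c] config_room_in[OF c] unfolding config_def by auto
  \<comment> \<open>The two piles that change are peeled off, so that the remaining sum agrees for
    \<open>p\<close> and \<open>q\<close>.\<close>
  have split: "(\<Sum>n\<in>I. mset (r n)) = mset (r i) + (mset (r j) + (\<Sum>n\<in>I - {i} - {j}. mset (r n)))"
    for r :: "nat \<Rightarrow> 'a list"
    using fin iI jI by (simp add: sum.remove[of I i] sum.remove[of "I - {i}" j])
  have "mset (p i) = add_mset (last (p i)) (mset (butlast (p i)))"
    using ij(2) by (metis append_butlast_last_id mset.simps(2) mset_append mset.simps(1)
        add_mset_add_single)
  moreover have "(\<Sum>n\<in>I - {i} - {j}. mset (q n)) = (\<Sum>n\<in>I - {i} - {j}. mset (p n))"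
    by (rule sum.cong) (auto simp: q)
  ultimately have "(\<Sum>n\<in>I. mset (q n)) = (\<Sum>n\<in>I. mset (p n))"
    using ij(1) by (simp add: split) (simp add: q)
  moreover have "length (q n) \<le> m n" for n
  proof -
    have "length (p n) \<le> m n" using c unfolding config_def by blast
    then show ?thesis using ij by (auto simp: q)
  qed
  ultimately show ?thesis using c unfolding config_def by simp
qed

lemma config_steps: "(step m)\<^sup>*\<^sup>* p q \<Longrightarrow> config I m M p \<Longrightarrow> config I m M q"
  by (induction rule: rtranclp_induct) (auto intro: config_step)

text \<open>The pile that gave up its top card respected its capacity before, so it now has a place
  to take the card back. Reversibility allows two configurations to be joined by driving both
  towards a common shape.\<close>

lemma step_sym:
  assumes c: "config I m M p" and st: "step m p q"
  shows "step m q p"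
proof -
  obtain i j where ij: "i \<noteq> j" "p i \<noteq> []" "length (p j) < m j"
    and q: "q = p(i := butlast (p i), j := p j @ [last (p i)])"
    using st unfolding step_def by blast
  have "length (p i) \<le> m i" using c unfolding config_def by blast
  moreover have "0 < length (p i)" using ij(2) by simp
  ultimately have "length (q i) < m i" using ij(1) by (simp add: q del: length_greater_0_conv)
  moreover have "p = q(j := butlast (q j), i := q i @ [last (q j)])"
    using ij by (auto simp: q fun_eq_iff)
  moreover have "q j \<noteq> []" by (simp add: q)
  ultimately show ?thesis using ij(1) unfolding step_def by metis
qed

lemma steps_sym: "(step m)\<^sup>*\<^sup>* p q \<Longrightarrow> config I m M p \<Longrightarrow> (step m)\<^sup>*\<^sup>* q p"
proof (induction rule: rtranclp_induct)
  case (step y z)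
  then have "step m z y" using step_sym config_steps by blast
  then show ?case using step by (meson converse_rtranclp_into_rtranclp)
qed simp

lemma config_size: "config I m M p \<Longrightarrow> (\<Sum>i\<in>I. length (p i)) = size M"
  unfolding config_def by auto

section \<open>Bringing a card to the bottom of a pile\<close>

text \<open>If all other piles were full, every free place would lie on pile \<open>k\<close>; being
  nonempty, it has fewer than \<open>m k\<close> of them, against \<open>slack\<close>.\<close>

lemma exists_room:
  assumes c: "config I m M p" and sl: "slack I m (size M)" and ne: "p k \<noteq> []"
  shows "\<exists>i. i \<noteq> k \<and> length (p i) < m i"
proof (rule ccontr)
  assume no_room: "\<not> ?thesis"
  have full: "length (p i) = m i" if "i \<noteq> k" for i
  proof -
    have "length (p i) \<le> m i" using c unfolding config_def by blast
    then show ?thesis using no_room that by (meson le_neq_implies_less)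
  qed
  have fin: "finite I" and kI: "k \<in> I"
    using c config_nonempty_in[OF c ne] unfolding config_def by auto
  have "size M = length (p k) + (\<Sum>i\<in>I - {k}. length (p i))"
    using config_size[OF c] sum.remove[OF fin kI, of "\<lambda>i. length (p i)"] by simp
  also have "(\<Sum>i\<in>I - {k}. length (p i)) = (\<Sum>i\<in>I - {k}. m i)"
    using full by (intro sum.cong) auto
  finally have "size M + m k = length (p k) + sum m I"
    using sum.remove[OF fin kI, of m] by simp
  moreover have "size M + m k \<le> sum m I" using sl kI unfolding slack_def by blast
  ultimately show False using ne by simp
qed

text \<open>The cards above \<open>c\<close> are taken off from the top, each finding a place on
  another pile by \<open>exists_room\<close>; hence the induction on \<open>B\<close> from its right
  end.\<close>

lemma expose:
  assumes "config I m M p" "slack I m (size M)" "p j = A @ c # B"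
  shows "\<exists>q. (step m)\<^sup>*\<^sup>* p q \<and> q j = A @ [c]"
  using assms
proof (induction B arbitrary: p rule: rev_induct)
  case (snoc b B)
  obtain i where i: "i \<noteq> j" "length (p i) < m i"
    using exists_room[OF snoc.prems(1,2), of j] snoc.prems(3) by auto
  define p' where "p' = p(j := butlast (p j), i := p i @ [last (p j)])"
  have st: "step m p p'"
    unfolding p'_def using i snoc.prems(3) by (intro step_intro) auto
  have "p' j = A @ c # B"
    using i(1) snoc.prems(3) by (simp add: p'_def butlast_append)
  then obtain q where "(step m)\<^sup>*\<^sup>* p' q" "q j = A @ [c]"
    using snoc.IH config_step[OF snoc.prems(1) st] snoc.prems(2) by blast
  then show ?case using st by (meson converse_rtranclp_into_rtranclp)
qed auto

text \<open>Induction on the height of pile \<open>k\<close>. The card \<open>c\<close> must stay on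
  top of some pile outside \<open>k\<close>, but that pile may change, so \<open>j\<close> is
  generalised.\<close>

lemma clear_pile:
  assumes "config I m M p" "slack I m (size M)"
    and three: "card {i \<in> I. m i > 0} \<ge> 3"
    and "j \<noteq> k" "p j \<noteq> []" "last (p j) = c"
  shows "\<exists>q j'. (step m)\<^sup>*\<^sup>* p q \<and> q k = [] \<and> j' \<noteq> k \<and> q j' \<noteq> [] \<and> last (q j') = c"
  using assms(1,4-)
proof (induction "length (p k)" arbitrary: p j)
  case 0
  then show ?case by auto
next
  case (Suc n)
  note cfg = Suc.prems(1)
  have kne: "p k \<noteq> []" using Suc.hyps(2) by auto
  show ?case
  proof (cases "\<exists>l. l \<noteq> j \<and> l \<noteq> k \<and> length (p l) < m l")
    case True
    then obtain l where l: "l \<noteq> j" "l \<noteq> k" "length (p l) < m l" by blast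
    define p' where "p' = p(k := butlast (p k), l := p l @ [last (p k)])"
    have st: "step m p p'" unfolding p'_def using l kne by (intro step_intro) auto
    have "n = length (p' k)" "p' j = p j"
      using Suc.hyps(2) Suc.prems(2) l by (auto simp: p'_def)
    then obtain q j' where q: "(step m)\<^sup>*\<^sup>* p' q"
      "q k = []" "j' \<noteq> k" "q j' \<noteq> []" "last (q j') = c"
      using Suc.hyps(1)[of p' j] config_step[OF cfg st] Suc.prems by auto
    show ?thesis using converse_rtranclp_into_rtranclp[of "step m", OF st q(1)] q(2-) by blast
  next
    case False
    \<comment> \<open>All piles besides \<open>j\<close> and \<open>k\<close> are full now. The
      place that \<open>exists_room\<close> finds away from \<open>j\<close> is therefore on
      \<open>k\<close>, and the one away from \<open>k\<close> is on \<open>j\<close>.\<close>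
    have room_k: "length (p k) < m k"
      using exists_room[OF cfg assms(2), of j] Suc.prems(3) False by metis
    have room_j: "length (p j) < m j"
      using exists_room[OF cfg assms(2) kne] False by metis
    have "\<not> {i \<in> I. m i > 0} \<subseteq> {j, k}"
      using three card_mono[of "{j, k}" "{i \<in> I. m i > 0}"] card_insert_le_m1[of 2 "{k}" j] by auto
    then obtain l where l: "m l > 0" "l \<noteq> j" "l \<noteq> k" by auto
    have full_l: "length (p l) = m l"
      using False l cfg unfolding config_def by (metis le_neq_implies_less)
    then have lne: "p l \<noteq> []" using l(1) by auto
    \<comment> \<open>The top cards of \<open>j\<close> and \<open>l\<close> are exchanged via \<open>k\<close>; then \<open>c\<close> is out of the way on \<open>l\<close>
      and \<open>j\<close> can take a card from \<open>k\<close>.\<close>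
    define p1 where "p1 = p(j := butlast (p j), k := p k @ [last (p j)])"
    define p2 where "p2 = p1(l := butlast (p1 l), j := p1 j @ [last (p1 l)])"
    define p3 where "p3 = p2(k := butlast (p2 k), l := p2 l @ [last (p2 k)])"
    define p4 where "p4 = p3(k := butlast (p3 k), j := p3 j @ [last (p3 k)])"
    have jk: "j \<noteq> k" "p j \<noteq> []" "last (p j) = c" using Suc.prems by auto
    have p3: "p3 k = p k" "p3 l = butlast (p l) @ [c]" "p3 j = butlast (p j) @ [last (p l)]"
      using jk l by (auto simp: p1_def p2_def p3_def)
    have s1: "step m p p1"
      unfolding p1_def using jk room_k by (intro step_intro) auto
    have s2: "step m p1 p2"
      unfolding p2_def by (rule step_intro) (use jk l lne room_j in \<open>auto simp: p1_def\<close>)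
    have s3: "step m p2 p3"
      unfolding p3_def by (rule step_intro) (use jk l lne full_l in \<open>auto simp: p1_def p2_def\<close>)
    have s4: "step m p3 p4"
      unfolding p4_def by (rule step_intro) (use jk l kne room_j p3 in auto)
    have "config I m M p4" using cfg s1 s2 s3 s4 by (meson config_step)
    moreover have "n = length (p4 k)" "p4 l = butlast (p l) @ [c]"
      using Suc.hyps(2) jk l p3 by (auto simp: p4_def)
    ultimately obtain q j' where q: "(step m)\<^sup>*\<^sup>* p4 q"
      "q k = []" "j' \<noteq> k" "q j' \<noteq> []" "last (q j') = c"
      using Suc.hyps(1)[of p4 l] l by auto
    have "(step m)\<^sup>*\<^sup>* p p4" using s1 s2 s3 s4 by (simp add: rtranclp.rtrancl_into_rtrancl)
    from rtranclp_trans[OF this q(1)] show ?thesis using q(2-) by blast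
  qed
qed

text \<open>The card is exposed, kept on top of another pile while \<open>k\<close> is emptied, and
  then placed on the empty pile \<open>k\<close>.\<close>

lemma bring_to_bottom:
  assumes cfg: "config I m M p" and sl: "slack I m (size M)"
    and three: "card {i \<in> I. m i > 0} \<ge> 3" and mk: "m k > 0" and "c \<in># M"
  shows "\<exists>q t. (step m)\<^sup>*\<^sup>* p q \<and> q k = c # t"
proof -
  have "c \<in># (\<Sum>i\<in>I. mset (p i))" and "finite I" using assms(1,5) unfolding config_def by auto
  then obtain j where "c \<in> set (p j)" by (auto simp: set_mset_sum)
  then obtain A B where "p j = A @ c # B" by (meson split_list)
  then obtain p1 where p1: "(step m)\<^sup>*\<^sup>* p p1" "p1 j = A @ [c]"
    using expose[OF cfg sl] by blast
  have cfg1: "config I m M p1" using config_steps p1(1) cfg by blast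
  \<comment> \<open>\<open>clear_pile\<close> wants \<open>c\<close> outside \<open>k\<close>; if it
    was exposed on \<open>k\<close> itself, one extra step moves it away.\<close>
  have "\<exists>p2 j. (step m)\<^sup>*\<^sup>* p1 p2 \<and> j \<noteq> k \<and> p2 j \<noteq> [] \<and> last (p2 j) = c"
  proof (cases "j = k")
    case True
    obtain i where i: "i \<noteq> j" "length (p1 i) < m i"
      using exists_room[OF cfg1 sl, of j] p1(2) by auto
    have "step m p1 (p1(j := butlast (p1 j), i := p1 i @ [last (p1 j)]))"
      using i p1(2) by (intro step_intro) auto
    moreover have "(p1(j := butlast (p1 j), i := p1 i @ [last (p1 j)])) i = p1 i @ [c]"
      using p1(2) by simp
    ultimately show ?thesis using i(1) True
      by (metis r_into_rtranclp snoc_eq_iff_butlast)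
  next
    case False
    then show ?thesis using p1(2) by (metis rtranclp.rtrancl_refl snoc_eq_iff_butlast)
  qed
  then obtain p2 j2 where p2: "(step m)\<^sup>*\<^sup>* p1 p2" "j2 \<noteq> k" "p2 j2 \<noteq> []" "last (p2 j2) = c"
    by blast
  have cfg2: "config I m M p2" using config_steps p2(1) cfg1 by blast
  obtain p3 j3 where p3: "(step m)\<^sup>*\<^sup>* p2 p3" "p3 k = []" "j3 \<noteq> k" "p3 j3 \<noteq> []" "last (p3 j3) = c"
    using clear_pile[OF cfg2 sl three p2(2-4)] by blast
  have "step m p3 (p3(j3 := butlast (p3 j3), k := p3 k @ [last (p3 j3)]))"
    using p3 mk by (intro step_intro) auto
  moreover have "(p3(j3 := butlast (p3 j3), k := p3 k @ [last (p3 j3)])) k = [c]"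
    using p3 by simp
  ultimately show ?thesis using p1(1) p2(1) p3(1)
    by (meson rtranclp.rtrancl_into_rtrancl rtranclp_trans)
qed

section \<open>Connectivity\<close>

lemma single_card_connected:
  assumes p: "config I m {#c#} p" and q: "config I m {#c#} q"
  shows "(step m)\<^sup>*\<^sup>* p q"
proof -
  have one: "\<exists>i. r = (\<lambda>_. [])(i := [c])" if r: "config I m {#c#} r" for r
  proof -
    have fin: "finite I" and sum: "(\<Sum>i\<in>I. mset (r i)) = {#c#}"
      using r unfolding config_def by auto
    have "c \<in># (\<Sum>i\<in>I. mset (r i))" by (simp add: sum)
    then obtain i where i: "i \<in> I" "c \<in> set (r i)" using fin by (auto simp: set_mset_sum)
    have eq: "mset (r i) + (\<Sum>n\<in>I - {i}. mset (r n)) = {#c#}"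
      using sum sum.remove[OF fin i(1), of "\<lambda>i. mset (r i)"] by simp
    have ri: "r i = [c]"
    proof -
      have "mset (r i) \<subseteq># {#c#}" using eq by (metis mset_subset_eq_add_left)
      moreover have "mset (r i) \<noteq> {#}" using i(2) by auto
      ultimately show ?thesis
        by (metis mset_single_iff nonempty_subseteq_mset_eq_single)
    qed
    have "r n = []" if "n \<noteq> i" for n
    proof (cases "n \<in> I")
      case True
      have "(\<Sum>n\<in>I - {i}. mset (r n)) = {#}" using eq ri by simp
      from arg_cong[OF this, of set_mset] show ?thesis
        using True that fin by (simp add: set_mset_sum)
    next
      case False
      then show ?thesis using config_nonempty_in[OF r] by blast
    qed
    then show ?thesis using ri by (intro exI[of _ i]) auto
  qed
  obtain i j where i: "p = (\<lambda>_. [])(i := [c])" and j: "q = (\<lambda>_. [])(j := [c])"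
    using one[OF p] one[OF q] by blast
  show ?thesis
  proof (cases "i = j")
    case False
    \<comment> \<open>Since \<open>q\<close> holds the card on pile \<open>j\<close>, this capacity
      is at least one, so the empty pile \<open>j\<close> of \<open>p\<close> can receive it in a
      single step.\<close>
    have "length (q j) \<le> m j" using q unfolding config_def by blast
    then have "step m p (p(i := butlast (p i), j := p j @ [last (p i)]))"
      using False by (intro step_intro) (auto simp: i j)
    moreover have "p(i := butlast (p i), j := p j @ [last (p i)]) = q"
      using False by (auto simp: i j fun_eq_iff)
    ultimately show ?thesis by auto
  qed (simp add: i j)
qed

text \<open>A card slid under pile \<open>k\<close>, together with one more place there, is never
  touched: a pile that is nonempty without it still has the same top card with it. This lifts
  solutions of the smaller problem in the induction.\<close>

lemma step_add_bottom:
  assumes st: "step m p q" and m': "m' = m(k := Suc (m k))"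
  shows "step m' (p(k := c # p k)) (q(k := c # q k))"
proof -
  obtain i j where ij: "i \<noteq> j" "p i \<noteq> []" "length (p j) < m j"
    and q: "q = p(i := butlast (p i), j := p j @ [last (p i)])"
    using st unfolding step_def by blast
  let ?p = "p(k := c # p k)"
  have "q(k := c # q k) = ?p(i := butlast (?p i), j := ?p j @ [last (?p i)])"
    using ij by (auto simp: q fun_eq_iff)
  then show ?thesis using ij step_intro[of i j ?p m'] by (auto simp: m')
qed

lemma steps_add_bottom:
  "(step m)\<^sup>*\<^sup>* p q \<Longrightarrow> (step (m(k := Suc (m k))))\<^sup>*\<^sup>* (p(k := c # p k)) (q(k := c # q k))"
proof (induction rule: rtranclp_induct)
  case (step y z)
  then show ?case using step_add_bottom[OF step.hyps(2) refl] by (meson rtranclp.rtrancl_into_rtrancl)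
qed simp

lemma config_remove_bottom:
  assumes cfg: "config I m M p" and pk: "p k = c # t"
  shows "config I (m(k := m k - 1)) (M - {#c#}) (p(k := t))"
proof -
  have fin: "finite I" and kI: "k \<in> I" and len: "length (p n) \<le> m n" for n
    using cfg config_nonempty_in[OF cfg] pk unfolding config_def by auto
  have "(\<Sum>n\<in>I - {k}. mset ((p(k := t)) n)) = (\<Sum>n\<in>I - {k}. mset (p n))"
    by (rule sum.cong) auto
  moreover have "M = (\<Sum>n\<in>I. mset (p n))" using cfg unfolding config_def by simp
  ultimately have "(\<Sum>n\<in>I. mset ((p(k := t)) n)) = M - {#c#}"
    using fin kI pk by (simp add: sum.remove[of I k])
  then show ?thesis using cfg len[of k] pk unfolding config_def by auto
qed

theorem config_connected:
  assumes "config I m M p" "config I m M q" "slack I m (size M)" "size M > 0"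
    and "size M = 1 \<or> card {i \<in> I. m i > 0} \<ge> 3"
  shows "(step m)\<^sup>*\<^sup>* p q"
  using assms
proof (induction "size M - 1" arbitrary: m M p q)
  case 0
  then have "size M = 1" by simp
  then obtain c where "M = {#c#}" by (meson size_1_singleton_mset)
  then show ?case using single_card_connected[of I m c p q] 0 by simp
next
  case (Suc n)
  note cfgp = Suc.prems(1) and cfgq = Suc.prems(2) and sl = Suc.prems(3)
  define S where "S m = {i \<in> I. m i > 0}" for m :: "nat \<Rightarrow> nat"
  have big: "size M \<ge> 2" and three: "card (S m) \<ge> 3"
    using Suc.hyps(2) Suc.prems(5) by (auto simp: S_def)
  have fin: "finite I" using cfgp unfolding config_def by simp
  then have finS: "finite (S m)" by (simp add: S_def)
  \<comment> \<open>Shortening a pile of largest capacity is what preserves the three usable piles: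
    a pile becomes unusable only if all usable capacities equal one.\<close>
  obtain k where k: "k \<in> S m" and kmax: "\<And>i. i \<in> S m \<Longrightarrow> m i \<le> m k"
  proof -
    have "S m \<noteq> {}" using three by auto
    then have "Max (m ` S m) \<in> m ` S m" using finS by simp
    then obtain k where "k \<in> S m" "Max (m ` S m) = m k" by auto
    then show thesis using that[of k] finS by (metis Max_ge finite_imageI imageI)
  qed
  have kI: "k \<in> I" and mk: "m k > 0" using k by (auto simp: S_def)
  obtain c where c: "c \<in># M" using big by fastforce
  obtain p1 tp where p1: "(step m)\<^sup>*\<^sup>* p p1" "p1 k = c # tp"
    using bring_to_bottom[OF cfgp sl _ mk c] three by (auto simp: S_def)
  obtain q1 tq where q1: "(step m)\<^sup>*\<^sup>* q q1" "q1 k = c # tq"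
    using bring_to_bottom[OF cfgq sl _ mk c] three by (auto simp: S_def)
  define m' where "m' = m(k := m k - 1)"
  have "config I m M p1" "config I m M q1" using config_steps p1 q1 cfgp cfgq by blast+
  then have cfg': "config I m' (M - {#c#}) (p1(k := tp))" "config I m' (M - {#c#}) (q1(k := tq))"
    unfolding m'_def using config_remove_bottom p1(2) q1(2) by fast+
  have size': "size (M - {#c#}) = size M - 1" using c by (simp add: size_Diff_singleton)
  have "sum m' (I - {k}) = sum m (I - {k})" by (rule sum.cong) (auto simp: m'_def)
  then have sum': "sum m I = Suc (sum m' I)"
    using sum.remove[OF fin kI, of m] sum.remove[OF fin kI, of m'] mk by (simp add: m'_def)
  \<comment> \<open>Cards and total capacity both drop by one, and no single capacity grows.\<close>
  have sl': "slack I m' (size (M - {#c#}))"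
    unfolding slack_def
  proof
    fix j assume "j \<in> I"
    then have "size M + m j \<le> sum m I" using sl unfolding slack_def by blast
    moreover have "m' j \<le> m j" by (simp add: m'_def)
    ultimately show "size (M - {#c#}) + m' j \<le> sum m' I" using sum' size' big by linarith
  qed
  have three': "size (M - {#c#}) = 1 \<or> card (S m') \<ge> 3"
  proof (cases "m k \<ge> 2")
    case True
    then have "S m' = S m" by (auto simp: S_def m'_def)
    then show ?thesis using three by simp
  next
    case False
    then have ones: "m i = 1" if "i \<in> S m" for i
      using kmax[OF that] that by (auto simp: S_def)
    have "sum m I = sum m (S m)"
      by (rule sum.mono_neutral_right) (auto simp: S_def fin)
    also have "\<dots> = card (S m)" using ones by simp
    \<comment> \<open>With unit capacities, \<open>slack\<close> at \<open>k\<close> says that there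
      are more usable piles than cards. After losing one pile there are still at least
      \<open>size M\<close>, which is at least three unless only one card remains.\<close>
    finally have "size M + 1 \<le> card (S m)"
      using sl kI ones[OF k] unfolding slack_def by force
    moreover have "S m' = S m - {k}" using ones[OF k] by (auto simp: S_def m'_def)
    ultimately have "size M \<le> card (S m')" using k finS by simp
    then show ?thesis using size' big by linarith
  qed
  have "(step m')\<^sup>*\<^sup>* (p1(k := tp)) (q1(k := tq))"
    using Suc.hyps(1)[OF _ cfg' sl'] three' size' Suc.hyps(2) by (simp add: S_def)
  from steps_add_bottom[OF this, of k c]
  have "(step m)\<^sup>*\<^sup>* (p1(k := c # tp)) (q1(k := c # tq))"
    using mk by (simp add: m'_def)
  then have "(step m)\<^sup>*\<^sup>* p1 q1" using p1(2) q1(2) by (metis fun_upd_triv)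
  then show ?case using p1(1) steps_sym[OF q1(1) cfgq] by (meson rtranclp_trans)
qed

section \<open>States as lists of piles\<close>

text \<open>No card has multiplicity above one in \<open>mset_set W\<close>, so a repetition within
  a pile or across two piles would make the sum too large at that card.\<close>

lemma is_state_mset:
  assumes "finite W"
  shows "is_state W s m P \<longleftrightarrow> length P = s + 1 \<and> (\<Sum>i\<le>s. mset (P ! i)) = mset_set W \<and>
    (\<forall>i\<le>s. length (P ! i) \<le> m i)" (is "?L \<longleftrightarrow> ?R")
proof
  assume st: ?L
  have "(\<Sum>i\<in>J. mset (P ! i)) = mset_set (\<Union>i\<in>J. set (P ! i))" if "J \<subseteq> {..s}" for J
    using finite_subset[OF that finite_atMost] that
  proof (induction J rule: finite_induct)
    case (insert x J)
    have "set (P ! x) \<inter> (\<Union>i\<in>J. set (P ! i)) = {}"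
      using st insert.hyps(2) insert.prems unfolding is_state_def by fastforce
    moreover have "distinct (P ! x)" using st insert.prems unfolding is_state_def by auto
    ultimately show ?case using insert by (simp add: mset_set_Union mset_set_set)
  qed simp
  from this[OF subset_refl] show ?R using st unfolding is_state_def by auto
next
  assume R: ?R
  then have sum: "(\<Sum>i\<le>s. mset (P ! i)) = mset_set W" by blast
  have cnt: "(\<Sum>i\<le>s. count (mset (P ! i)) x) \<le> 1" for x
    using arg_cong[OF sum, of "\<lambda>M. count M x"] assms by (simp add: count_sum count_mset_set')
  have dis: "distinct (P ! i)" if "i \<le> s" for i
  proof -
    have le: "count (mset (P ! i)) x \<le> 1" for x
      using member_le_sum[of i "{..s}" "\<lambda>i. count (mset (P ! i)) x"] that cnt[of x] by auto
    show ?thesis unfolding distinct_count_atmost_1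
    proof
      fix x
      show "count (mset (P ! i)) x = (if x \<in> set (P ! i) then 1 else 0)"
        using le[of x] by (cases "x \<in> set (P ! i)") (auto simp: le_Suc_eq count_eq_zero_iff)
    qed
  qed
  have disj: "set (P ! i) \<inter> set (P ! j) = {}" if "i \<le> s" "j \<le> s" "i \<noteq> j" for i j
  proof (rule ccontr)
    assume "set (P ! i) \<inter> set (P ! j) \<noteq> {}"
    then obtain x where "x \<in> set (P ! i)" "x \<in> set (P ! j)" by blast
    then have "count (mset (P ! i)) x > 0" "count (mset (P ! j)) x > 0" by auto
    moreover have "(\<Sum>n\<in>{i, j}. count (mset (P ! n)) x) \<le> (\<Sum>n\<le>s. count (mset (P ! n)) x)"
      using that by (intro sum_mono2) auto
    moreover have "(\<Sum>n\<in>{i, j}. count (mset (P ! n)) x) =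
        count (mset (P ! i)) x + count (mset (P ! j)) x"
      using that by simp
    ultimately show False using cnt[of x] by linarith
  qed
  have "(\<Union>i\<le>s. set (P ! i)) = W"
    using arg_cong[OF sum, of set_mset] assms by (simp add: set_mset_sum)
  then show ?L using R dis disj unfolding is_state_def by blast
qed

text \<open>The default \<open>[]\<close> matches the zero capacity beyond \<open>s\<close>;
  \<open>P ! i\<close> is unspecified there.\<close>

definition pile_fun :: "nat \<Rightarrow> 'a list list \<Rightarrow> nat \<Rightarrow> 'a list" where
  "pile_fun s P i = (if i \<le> s then P ! i else [])"

lemma config_is_state:
  assumes "finite W" "config {..s} (\<lambda>i. if i \<le> s then m i else 0) (mset_set W) p"
  shows "is_state W s m (map p [0..<Suc s])"
proof -
  have "length (p i) \<le> m i" if "i \<le> s" for i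
    using assms(2) that unfolding config_def by (metis (mono_tags, lifting))
  moreover have "(\<Sum>i\<le>s. mset (map p [0..<Suc s] ! i)) = (\<Sum>i\<le>s. mset (p i))"
    by (rule sum.cong) (auto simp del: upt_Suc)
  ultimately show ?thesis
    using assms unfolding is_state_mset[OF assms(1)] config_def by (auto simp del: upt_Suc)
qed

lemma is_state_config:
  assumes "finite W" "is_state W s m P"
  shows "config {..s} (\<lambda>i. if i \<le> s then m i else 0) (mset_set W) (pile_fun s P)"
  using assms unfolding is_state_mset[OF assms(1)] config_def by (auto simp: pile_fun_def)

lemma step_is_move:
  assumes "finite W" and cfg: "config {..s} m' (mset_set W) p" and st: "step m' p q"
    and m': "m' = (\<lambda>i. if i \<le> s then m i else 0)"
  shows "is_move W s m (map p [0..<Suc s]) (map q [0..<Suc s])"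
proof -
  obtain i j where ij: "i \<noteq> j" "p i \<noteq> []" "length (p j) < m' j"
    and q: "q = p(i := butlast (p i), j := p j @ [last (p i)])"
    using st unfolding step_def by blast
  have "i \<le> s" "j \<le> s"
    using config_nonempty_in[OF cfg ij(2)] config_room_in[OF cfg ij(3)] by auto
  moreover from this have "map q [0..<Suc s] = (map p [0..<Suc s])
      [i := butlast (map p [0..<Suc s] ! i), j := map p [0..<Suc s] ! j @ [last (map p [0..<Suc s] ! i)]]"
    by (intro nth_equalityI) (auto simp: q nth_list_update simp del: upt_Suc)
  moreover have "is_state W s m (map p [0..<Suc s])" "is_state W s m (map q [0..<Suc s])"
    using config_is_state[OF assms(1)] cfg config_step[OF cfg st] unfolding m' by blast+
  ultimately show ?thesis
    using ij unfolding is_move_def by (metis (no_types, lifting) add_0 diff_zero le_imp_less_Suc nth_map_upt)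
qed

lemma steps_is_moves:
  assumes "(step m')\<^sup>*\<^sup>* p q" "finite W" "config {..s} m' (mset_set W) p"
    and "m' = (\<lambda>i. if i \<le> s then m i else 0)"
  shows "(is_move W s m)\<^sup>*\<^sup>* (map p [0..<Suc s]) (map q [0..<Suc s])"
  using assms(1)
proof (induction rule: rtranclp_induct)
  case (step y z)
  have "config {..s} m' (mset_set W) y" using config_steps[OF step.hyps(1) assms(3)] .
  then show ?case
    using step step_is_move[OF assms(2) _ step.hyps(2) assms(4)] by (meson rtranclp.rtrancl_into_rtrancl)
qed simp

lemma map_pile_fun: "length P = s + 1 \<Longrightarrow> map (pile_fun s P) [0..<Suc s] = P"
  by (rule nth_equalityI) (auto simp: pile_fun_def simp del: upt_Suc)

lemma states_connected:
  assumes W: "finite W" "card W > 0" and P: "is_state W s m P" and Q: "is_state W s m Q"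
    and cond: "card W = 1 \<or>
      s \<ge> 2 \<and> (\<forall>i\<le>s. m i > 0) \<and> (\<forall>k\<le>s. card W + m k \<le> (\<Sum>i\<le>s. m i))"
  shows "(is_move W s m)\<^sup>*\<^sup>* P Q"
proof -
  define m' where "m' = (\<lambda>i. if i \<le> s then m i else 0)"
  have cP: "config {..s} m' (mset_set W) (pile_fun s P)"
    and cQ: "config {..s} m' (mset_set W) (pile_fun s Q)"
    unfolding m'_def using is_state_config W P Q by blast+
  have "(step m')\<^sup>*\<^sup>* (pile_fun s P) (pile_fun s Q)"
  proof (cases "card W = 1")
    case True
    then obtain c where "W = {c}" using card_1_singletonE by blast
    then show ?thesis using single_card_connected cP cQ by fastforce
  next
    case False
    have "sum m' {..s} = (\<Sum>i\<le>s. m i)" by (rule sum.cong) (auto simp: m'_def)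
    then have "slack {..s} m' (size (mset_set W))"
      using cond False unfolding slack_def by (auto simp: m'_def)
    moreover have "{i \<in> {..s}. m' i > 0} = {..s}" using cond False by (auto simp: m'_def)
    ultimately show ?thesis
      using config_connected[OF cP cQ] W(2) cond False by simp
  qed
  from steps_is_moves[OF this W(1) cP m'_def] show ?thesis
    using P Q by (simp add: map_pile_fun is_state_def del: upt_Suc)
qed

section \<open>Unsolvable puzzles\<close>

text \<open>Supplies starting states that differ from the finishing state only by a permutation of
  the cards, against which the invariants below are tested.\<close>

lemma is_state_relabel:
  assumes P: "is_state W s m P" and \<pi>: "bij_betw \<pi> W W"
  shows "is_state W s m (map (map \<pi>) P)"
proof -
  have len: "length P = s + 1" and un: "(\<Union>i\<le>s. set (P ! i)) = W"
    using P unfolding is_state_def by auto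
  have sub: "set (P ! i) \<subseteq> W" if "i \<le> s" for i using un that by blast
  have nth: "map (map \<pi>) P ! i = map \<pi> (P ! i)" if "i \<le> s" for i using len that by simp
  have inj: "inj_on \<pi> W" and im: "\<pi> ` W = W" using \<pi> by (auto simp: bij_betw_def)
  have "distinct (map \<pi> (P ! i))" if "i \<le> s" for i
    using P that sub[OF that] inj unfolding is_state_def by (auto simp: distinct_map intro: inj_on_subset)
  moreover have "set (map \<pi> (P ! i)) \<inter> set (map \<pi> (P ! j)) = {}" if "i \<le> s" "j \<le> s" "i \<noteq> j" for i j
  proof -
    have "\<pi> ` set (P ! i) \<inter> \<pi> ` set (P ! j) = \<pi> ` (set (P ! i) \<inter> set (P ! j))"
      using inj_on_image_Int[OF inj sub[OF that(1)] sub[OF that(2)]] by simp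
    then show ?thesis using P that unfolding is_state_def by auto
  qed
  moreover have "(\<Union>i\<le>s. set (map \<pi> (P ! i))) = W"
  proof -
    have "(\<Union>i\<le>s. set (map \<pi> (P ! i))) = \<pi> ` (\<Union>i\<le>s. set (P ! i))" by auto
    then show ?thesis using un im by simp
  qed
  ultimately show ?thesis using P len nth unfolding is_state_def by simp
qed

lemma moves_invariant:
  assumes "(is_move W s m)\<^sup>*\<^sup>* P Q" and "\<And>P Q. is_move W s m P Q \<Longrightarrow> g Q = g P"
  shows "g Q = g P"
  using assms(1) by (induction rule: rtranclp_induct) (auto simp: assms(2))

text \<open>The two top cards are adjacent in this word, and a move only shifts the border between
  the piles by one card.\<close>

lemma two_piles_word:
  assumes "is_move W 1 m P Q"
  shows "Q ! 0 @ rev (Q ! 1) = P ! 0 @ rev (P ! 1)"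
proof -
  obtain i j where ij: "i \<le> 1" "j \<le> 1" "i \<noteq> j" "P ! i \<noteq> []"
    and Q: "Q = P[i := butlast (P ! i), j := P ! j @ [last (P ! i)]]"
    using assms unfolding is_move_def by blast
  have len: "length P = 2" using assms unfolding is_move_def is_state_def by simp
  have split: "butlast (P ! i) @ last (P ! i) # xs = P ! i @ xs" for xs
    using ij(4) by (metis append_Cons append_Nil append_assoc append_butlast_last_id)
  have rsplit: "last (P ! i) # rev (butlast (P ! i)) = rev (P ! i)"
    using ij(4) by (metis append_butlast_last_id rev.simps(2) rev_swap)
  consider "i = 0" "j = 1" | "i = 1" "j = 0" using ij by linarith
  then show ?thesis using len split rsplit by cases (auto simp: Q nth_list_update)
qed

text \<open>The other piles together have fewer than \<open>card W\<close> places.\<close>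

lemma tight_pile_nonempty:
  assumes "finite W" and P: "is_state W s m P" and k: "k \<le> s" and lt: "(\<Sum>i\<le>s. m i) < card W + m k"
  shows "P ! k \<noteq> []"
proof
  assume empty: "P ! k = []"
  have sum: "(\<Sum>i\<le>s. mset (P ! i)) = mset_set W" and len: "\<And>i. i \<le> s \<Longrightarrow> length (P ! i) \<le> m i"
    using P is_state_mset[OF assms(1)] by blast+
  have "card W = (\<Sum>i\<le>s. length (P ! i))"
    using arg_cong[OF sum, of size] by simp
  also have "\<dots> = (\<Sum>i\<in>{..s} - {k}. length (P ! i))"
    using k empty by (simp add: sum.remove[of "{..s}" k])
  also have "\<dots> \<le> (\<Sum>i\<in>{..s} - {k}. m i)" using len by (intro sum_mono) auto
  finally show False using lt k by (simp add: sum.remove[of "{..s}" k])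
qed

text \<open>Pile \<open>k\<close> is nonempty both before and after the move, so the card that
  leaves or joins it is never its bottom card, which is the \<open>hd\<close>.\<close>

lemma tight_pile_bottom:
  assumes "finite W" and mv: "is_move W s m P Q" and k: "k \<le> s"
    and lt: "(\<Sum>i\<le>s. m i) < card W + m k"
  shows "hd (Q ! k) = hd (P ! k)"
proof -
  obtain i j where ij: "i \<le> s" "j \<le> s" "i \<noteq> j"
    and Q: "Q = P[i := butlast (P ! i), j := P ! j @ [last (P ! i)]]"
    and states: "is_state W s m P" "is_state W s m Q"
    using mv unfolding is_move_def by blast
  have len: "length P = s + 1" using states unfolding is_state_def by simp
  have ne: "P ! k \<noteq> []" "Q ! k \<noteq> []"
    using tight_pile_nonempty[OF assms(1) _ k lt] states by auto
  consider "k = i" | "k = j" | "k \<noteq> i" "k \<noteq> j" by blast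
  then show ?thesis
  proof cases
    case 1
    then have "Q ! k = butlast (P ! k)" using len ij by (simp add: Q)
    then show ?thesis using ne by (metis append_butlast_last_id hd_append2)
  next
    case 2
    then show ?thesis using len ij ne by (simp add: Q)
  next
    case 3
    then show ?thesis by (simp add: Q)
  qed
qed

text \<open>A chosen card \<open>c\<close> is transposed with a second card throughout
  \<open>f\<close>. Solvability then links the relabelled state to \<open>f\<close>, so any
  invariant that sees \<open>c\<close> yields a contradiction.\<close>

lemma swapped_start:
  assumes W: "finite W" "card W > 1" and f: "is_state W s m f" and "always_solvable W s m {f}"
    and c: "c \<in> W"
  obtains \<pi> where "\<pi> c \<noteq> c" "is_state W s m (map (map \<pi>) f)" "(is_move W s m)\<^sup>*\<^sup>* (map (map \<pi>) f) f"
proof -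
  have "W \<noteq> {c}" using W(2) by auto
  then obtain d where d: "d \<in> W" "d \<noteq> c" using c by blast
  have "bij_betw (transpose c d) W W"
    using c d by (auto simp: bij_betw_def transpose_image_eq intro: inj_on_subset[OF inj_transpose])
  then have "is_state W s m (map (map (transpose c d)) f)" using is_state_relabel f by blast
  then show thesis using that[of "transpose c d"] d assms(4) unfolding always_solvable_def by auto
qed

lemma two_piles_unsolvable:
  assumes W: "finite W" "card W > 1" and f: "is_state W 1 m f"
  shows "\<not> always_solvable W 1 m {f}"
proof
  assume sol: "always_solvable W 1 m {f}"
  obtain c where c: "c \<in> W" using W(2) by fastforce
  obtain \<pi> where \<pi>: "\<pi> c \<noteq> c" "(is_move W 1 m)\<^sup>*\<^sup>* (map (map \<pi>) f) f"
    using swapped_start[OF W f sol c] by blast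
  have len: "length f = 2" and un: "(\<Union>i\<le>1. set (f ! i)) = W"
    using f unfolding is_state_def by auto
  let ?u = "f ! 0 @ rev (f ! 1)"
  \<comment> \<open>Equal words force the relabelling to fix every card; writing
    \<open>map id\<close> lets \<open>map_eq_conv\<close> give this pointwise.\<close>
  have "map id ?u = map \<pi> ?u"
    using moves_invariant[OF \<pi>(2), of "\<lambda>P. P ! 0 @ rev (P ! 1)", OF two_piles_word] len
    by (simp add: rev_map)
  moreover have "c \<in> set ?u" using un c by (auto simp: atMost_Suc le_Suc_eq)
  ultimately show False using \<pi>(1) unfolding map_eq_conv by auto
qed

lemma tight_unsolvable:
  assumes W: "finite W" "card W > 1" and f: "is_state W s m f"
    and k: "k \<le> s" and lt: "(\<Sum>i\<le>s. m i) < card W + m k"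
  shows "\<not> always_solvable W s m {f}"
proof
  assume sol: "always_solvable W s m {f}"
  have ne: "f ! k \<noteq> []" using tight_pile_nonempty[OF W(1) f k lt] .
  have len: "length f = s + 1" and un: "(\<Union>i\<le>s. set (f ! i)) = W"
    using f unfolding is_state_def by auto
  have "hd (f ! k) \<in> W" using un ne k by (metis UN_I atMost_iff hd_in_set)
  then obtain \<pi> where \<pi>: "\<pi> (hd (f ! k)) \<noteq> hd (f ! k)" "(is_move W s m)\<^sup>*\<^sup>* (map (map \<pi>) f) f"
    using swapped_start[OF W f sol] by blast
  have "hd (f ! k) = hd (map (map \<pi>) f ! k)"
    using moves_invariant[OF \<pi>(2), of "\<lambda>P. hd (P ! k)"] tight_pile_bottom[OF W(1) _ k lt] by simp
  then show False using \<pi>(1) len k ne by (simp add: hd_map)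
qed

theorem theorem2:
  fixes W :: "'a set" and w s :: nat and m :: "nat \<Rightarrow> nat" and F :: "'a list list set"
  assumes "finite W" and "card W = w"
    and "w > 0" and "s > 0" and "\<forall>i\<le>s. m i > 0"
    and "w \<le> (\<Sum>i=0..s. m i)"
    and "\<exists>f. is_state W s m f \<and> F = {f}"
  shows "(w = 1 \<longrightarrow> always_solvable W s m F) \<and>
    (w > 1 \<longrightarrow>
      (always_solvable W s m F \<longleftrightarrow>
        \<not> (s = 1 \<or> (\<Sum>i=0..s. m i) < w + (MAX i\<in>{0..s}. m i))))"
proof -
  obtain f where f: "is_state W s m f" "F = {f}" using assms(7) by blast
  have sum: "(\<Sum>i=0..s. m i) = (\<Sum>i\<le>s. m i)" by (simp add: atLeast0AtMost)
  define mx where "mx = (MAX i\<in>{0..s}. m i)"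
  have mx_ge: "m k \<le> mx" if "k \<le> s" for k using that by (simp add: mx_def)
  \<comment> \<open>The maximum is attained at some pile \<open>k\<close>, the one whose bottom card
    is stuck in the tight case. Conversely, slack for \<open>mx\<close> gives slack for every
    pile.\<close>
  have "mx \<in> m ` {0..s}" unfolding mx_def by (rule Max_in) auto
  then obtain k where k: "k \<le> s" "mx = m k" by auto
  have solve: "always_solvable W s m F"
    if "card W = 1 \<or> s \<ge> 2 \<and> (\<forall>i\<le>s. m i > 0) \<and> (\<forall>k\<le>s. card W + m k \<le> (\<Sum>i\<le>s. m i))"
    using states_connected[OF assms(1) _ _ f(1) that] assms(2,3) f(2)
    unfolding always_solvable_def by blast
  have "always_solvable W s m F \<longleftrightarrow> \<not> (s = 1 \<or> (\<Sum>i\<le>s. m i) < w + mx)" if "w > 1"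
  proof
    assume "always_solvable W s m F"
    then show "\<not> (s = 1 \<or> (\<Sum>i\<le>s. m i) < w + mx)"
      using two_piles_unsolvable[of W m f] tight_unsolvable[of W s m f k] assms(1,2) that f k by auto
  next
    assume "\<not> (s = 1 \<or> (\<Sum>i\<le>s. m i) < w + mx)"
    then have "s \<ge> 2" "w + mx \<le> (\<Sum>i\<le>s. m i)" using assms(4) by auto
    then show "always_solvable W s m F"
      using assms(2,5) mx_ge by (intro solve) (meson add_left_mono le_trans)
  qed
  then show ?thesis using solve assms(2) unfolding sum mx_def by blast
qed

end
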